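(* For any rational constant $\beta \in (0,1)$ and constant $\varepsilon > 0$, every (possibly randomized) algorithm for SMC that guarantees an approximation ratio of $\beta + \varepsilon$ (in expectation) for instances obeying $k = \beta n$ must use $\Omega(n / \log n)$ value oracle queries. Moreover, this is true even when the objective function $f$ is guaranteed to be a (non-negative) linear function.
   Context: SMC: given a finite ground set $\mathcal{N}$ with $|\mathcal{N}| = n$, an integer $1 \leq k \leq n$, and a non-negative monotone submodular function $f\colon 2^{\mathcal{N}} \to \mathbb{R}_{\geq 0}$ accessible only through a value oracle, find a set $S \subseteq \mathcal{N}$ with $|S| \leq k$ maximizing $f(S)$. An algorithm guarantees approximation ratio $\gamma$ if its output $S$ satisfies $\mathbb{E}[f(S)] \geq \gamma \cdot \max_{|T| \leq k} f(T)$ on every instance. *)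

theory Defs
  imports "HOL-Probability.Probability"
begin

definition smc_objectives :: "'a set \<Rightarrow> ('a set \<Rightarrow> real) set" where
  "smc_objectives N = {f.
     (\<forall>S\<subseteq>N. 0 \<le> f S) \<and>
     (\<forall>S T. S \<subseteq> T \<and> T \<subseteq> N \<longrightarrow> f S \<le> f T) \<and>
     (\<forall>S T. S \<subseteq> N \<and> T \<subseteq> N \<longrightarrow> f (S \<union> T) + f (S \<inter> T) \<le> f S + f T)}"

definition linear_objectives :: "'a set \<Rightarrow> ('a set \<Rightarrow> real) set" where
  "linear_objectives N = {f. \<exists>w.
     (\<forall>x\<in>N. 0 \<le> w x) \<and> (\<forall>S\<subseteq>N. f S = (\<Sum>x\<in>S. w x))}"

lemma linear_objectives_subset_smc_objectives:
  assumes "finite N"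
  shows "linear_objectives N \<subseteq> smc_objectives N"
proof
  fix f assume "f \<in> linear_objectives N"
  then obtain w where w: "\<And>x. x \<in> N \<Longrightarrow> 0 \<le> w x"
    and f: "\<And>S. S \<subseteq> N \<Longrightarrow> f S = (\<Sum>x\<in>S. w x)"
    unfolding linear_objectives_def by auto
  have fin: "finite S" if "S \<subseteq> N" for S
    using assms that by (rule rev_finite_subset)
  have "0 \<le> f S" if "S \<subseteq> N" for S
    using that w by (auto simp: f intro!: sum_nonneg)
  moreover have "f S \<le> f T" if "S \<subseteq> T" "T \<subseteq> N" for S T
  proof -
    have "sum w S \<le> sum w T"
      using that w fin by (intro sum_mono2) auto
    then show ?thesis
      using that f by (metis subset_trans)
  qed
  moreover have "f (S \<union> T) + f (S \<inter> T) \<le> f S + f T" if "S \<subseteq> N" "T \<subseteq> N" for S T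
  proof -
    have "f (S \<union> T) = sum w (S \<union> T)" "f (S \<inter> T) = sum w (S \<inter> T)"
      using that by (auto intro!: f)
    then show ?thesis
      using that sum.union_inter[OF fin fin, of S T w] by (simp add: f)
  qed
  ultimately show "f \<in> smc_objectives N"
    unfolding smc_objectives_def by blast
qed

definition smc_opt :: "'a set \<Rightarrow> nat \<Rightarrow> ('a set \<Rightarrow> real) \<Rightarrow> real" where
  "smc_opt N k f = Max (f ` {T. T \<subseteq> N \<and> card T \<le> k})"

text \<open>
  A deterministic adaptive algorithm with value-query access: it either returns a set, or queries
  the value of a set and continues depending on the answer. Computation between queries is
  unrestricted. Branching is over all reals, so every run halts, but the number of queries need not
  be bounded over all objectives.
\<close>

datatype 'a query_tree =
    Return "'a set"
  | Query "'a set" "real \<Rightarrow> 'a query_tree"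

primrec run_output :: "'a query_tree \<Rightarrow> ('a set \<Rightarrow> real) \<Rightarrow> 'a set" where
  "run_output (Return S) f = S"
| "run_output (Query Q g) f = run_output (g (f Q)) f"

primrec run_queries :: "'a query_tree \<Rightarrow> ('a set \<Rightarrow> real) \<Rightarrow> 'a set list" where
  "run_queries (Return S) f = []"
| "run_queries (Query Q g) f = Q # run_queries (g (f Q)) f"

text \<open>
  A randomized algorithm is a family \<open>A\<close> of deterministic ones, indexed by the outcomes of an
  arbitrary probability space \<open>M\<close> (its internal randomness). For the objectives in \<open>F\<close>, it may query
  only subsets of the ground set, and its output is always feasible. Measurability makes the
  expected objective value and the expected number of queries meaningful.
\<close>

definition randomized_smc_algorithm ::
  "('a set \<Rightarrow> real) set \<Rightarrow> 'a set \<Rightarrow> nat \<Rightarrow> 'w measure \<Rightarrow> ('w \<Rightarrow> 'a query_tree) \<Rightarrow> bool" where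
  "randomized_smc_algorithm F N k M A \<longleftrightarrow>
     prob_space M \<and>
     (\<forall>f\<in>F.
        (\<lambda>\<omega>. run_output (A \<omega>) f) \<in> measurable M (count_space UNIV) \<and>
        (\<lambda>\<omega>. length (run_queries (A \<omega>) f)) \<in> measurable M (count_space UNIV) \<and>
        (\<forall>\<omega>\<in>space M.
           (\<forall>Q\<in>set (run_queries (A \<omega>) f). Q \<subseteq> N) \<and>
           run_output (A \<omega>) f \<subseteq> N \<and> card (run_output (A \<omega>) f) \<le> k))"

definition guarantees_ratio ::
  "('a set \<Rightarrow> real) set \<Rightarrow> 'a set \<Rightarrow> nat \<Rightarrow> 'w measure \<Rightarrow> ('w \<Rightarrow> 'a query_tree) \<Rightarrow> real \<Rightarrow> bool" where
  "guarantees_ratio F N k M A \<gamma> \<longleftrightarrow>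
     (\<forall>f\<in>F. \<gamma> * smc_opt N k f \<le> (\<integral>\<omega>. f (run_output (A \<omega>) f) \<partial>M))"

definition expected_queries ::
  "'w measure \<Rightarrow> ('w \<Rightarrow> 'a query_tree) \<Rightarrow> ('a set \<Rightarrow> real) \<Rightarrow> ennreal" where
  "expected_queries M A f = (\<integral>\<^sup>+\<omega>. of_nat (length (run_queries (A \<omega>) f)) \<partial>M)"

end

theory Submission
  imports Defs
begin

text \<open>
  By Yao's principle it suffices to defeat deterministic algorithms on a random instance. Let \<open>K\<close>
  contain every element independently with probability \<open>\<beta>\<close> and let the objective be the linear
  function \<open>S \<mapsto> |S \<inter> K|\<close>. The optimum is close to \<open>k = \<beta> n\<close> with high probability, whereas a fixed set
  of size at most \<open>k\<close> has value about \<open>\<beta> k\<close>, up to an exponentially small failure probability. An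
  algorithm making \<open>m\<close> queries has at most \<open>(n + 1) ^ m\<close> possible outputs, so for \<open>m\<close>
  a small multiple of \<open>n / log n\<close> a union bound shows that its output is no better than a fixed set.
  Independent sampling is used in place of a uniform \<open>k\<close>-subset: it gives binomial rather than
  hypergeometric tails, at the cost of a random optimum.
\<close>

section \<open>Random instances and their optimum\<close>

text \<open>Built from one independent coin per element, with default \<open>False\<close> outside
  \<open>N\<close>, so that restricting to a subset of \<open>N\<close> again yields independent
  coins.\<close>

definition random_subset :: "'a set \<Rightarrow> real \<Rightarrow> 'a set pmf" where
  "random_subset N p = map_pmf (\<lambda>b. {x\<in>N. b x}) (Pi_pmf N False (\<lambda>_. bernoulli_pmf p))"

definition overlap :: "'a set \<Rightarrow> 'a set \<Rightarrow> real" where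
  "overlap K S = real (card (S \<inter> K))"

lemma overlap_in_linear_objectives:
  assumes "finite N"
  shows "overlap K \<in> linear_objectives N"
proof -
  have "overlap K S = (\<Sum>x\<in>S. indicator K x)" if "S \<subseteq> N" for S
    using finite_subset[OF that assms]
    by (simp add: overlap_def indicator_def sum.If_cases Collect_mem_eq)
  then show ?thesis
    unfolding linear_objectives_def
    by (auto intro!: exI[of _ "\<lambda>x. indicator K x :: real"])
qed

lemma overlap_le_card:
  assumes "finite N" "S \<subseteq> N"
  shows "overlap K S \<le> card N"
  using assms by (auto simp: overlap_def intro!: card_mono)

text \<open>As many elements of \<open>K\<close> as the budget allows form a feasible set, and each
  of them counts.\<close>

lemma min_card_le_smc_opt_overlap:
  assumes "finite N" "K \<subseteq> N"
  shows "real (min k (card K)) \<le> smc_opt N k (overlap K)"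
proof -
  obtain T where T: "T \<subseteq> K" "card T = min k (card K)"
    using obtain_subset_with_card_n[of "min k (card K)" K] by auto
  then have "overlap K T = real (min k (card K))"
    by (simp add: overlap_def Int_absorb2)
  moreover have "overlap K T \<le> smc_opt N k (overlap K)"
    unfolding smc_opt_def using assms T by (intro Max_ge) auto
  ultimately show ?thesis by simp
qed

lemma set_pmf_random_subset: "set_pmf (random_subset N p) \<subseteq> Pow N"
  by (auto simp: random_subset_def)

lemma sum_pmf_random_subset:
  assumes "finite N"
  shows "(\<Sum>K\<in>Pow N. pmf (random_subset N p) K) = 1"
  using assms set_pmf_random_subset by (intro sum_pmf_eq_1) auto

section \<open>Binomial tail bounds\<close>

text \<open>Only the coins of \<open>S\<close> matter, and the number of successes among them is
  binomial.\<close>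

lemma card_Int_random_subset:
  fixes p :: real
  assumes "finite N" "S \<subseteq> N" "p \<in> {0..1}"
  shows "map_pmf (\<lambda>K. card (S \<inter> K)) (random_subset N p) = binomial_pmf (card S) p"
proof -
  have eq: "S \<inter> {x\<in>N. b x} = {x\<in>S. if x \<in> S then b x else False}" for b
    using assms(2) by auto
  have "binomial_pmf (card S) p =
      map_pmf (\<lambda>b. card {x\<in>S. b x}) (Pi_pmf S False (\<lambda>_. bernoulli_pmf p))"
    using assms finite_subset by (intro binomial_pmf_altdef') auto
  also have "\<dots> = map_pmf (\<lambda>K. card (S \<inter> K)) (random_subset N p)"
    unfolding Pi_pmf_subset[OF assms(1,2)] random_subset_def map_pmf_comp eq ..
  finally show ?thesis ..
qed

text \<open>Hoeffding's upper tail for a fixed set. The bound is weakened from \<open>card S\<close>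
  to \<open>k\<close> and \<open>card N\<close>, so that it is the same for all candidate outputs in
  the union bound.\<close>

lemma prob_overlap_ge:
  fixes p t :: real
  assumes "finite N" "S \<subseteq> N" "p \<in> {0..1}" "0 < t" "card S \<le> k"
  shows "measure_pmf.prob (random_subset N p) {K. p * k + t \<le> overlap K S}
           \<le> exp (- 2 * t\<^sup>2 / card N)"
\<comment> \<open>Hoeffding's exponent divides by \<open>card S\<close>. For empty \<open>S\<close>
  the event is impossible because \<open>p * k + t\<close> is positive.\<close>
proof (cases "S = {}")
  case True
  have "0 \<le> p * k" using assms by simp
  then show ?thesis
    using True \<open>0 < t\<close> by (simp add: overlap_def)
next
  case False
  then have S: "0 < card S" "card S \<le> card N"
    using assms finite_subset by (auto simp: card_gt_0_iff intro: card_mono)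
  interpret binomial_distribution "card S" p
    by standard (use assms in auto)
  have "p * card S \<le> p * k"
    using assms by (intro mult_left_mono) auto
  then have "measure_pmf.prob (random_subset N p) {K. p * k + t \<le> overlap K S}
      \<le> measure_pmf.prob (random_subset N p) {K. card S * p + t \<le> card (S \<inter> K)}"
    by (intro measure_pmf.finite_measure_mono) (auto simp: overlap_def mult.commute)
  also have "\<dots> = measure_pmf.prob (binomial_pmf (card S) p) {x. card S * p + t \<le> x}"
    by (subst card_Int_random_subset[OF assms(1-3), symmetric]) (simp add: vimage_def)
  also have "\<dots> \<le> exp (- 2 * t\<^sup>2 / card S)"
    using S assms by (intro prob_ge) auto
  also have "\<dots> \<le> exp (- 2 * t\<^sup>2 / card N)"
    using S by (auto intro!: divide_left_mono)
  finally show ?thesis .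
qed

text \<open>Hoeffding's lower tail for the size of the hidden set, which keeps the optimum from
  being small.\<close>

lemma prob_card_le:
  fixes p t :: real
  assumes "finite N" "N \<noteq> {}" "p \<in> {0..1}" "0 < t"
  shows "measure_pmf.prob (random_subset N p) {K. card (N \<inter> K) \<le> p * card N - t}
           \<le> exp (- 2 * t\<^sup>2 / card N)"
proof -
  interpret binomial_distribution "card N" p
    by standard (use assms in auto)
  have "measure_pmf.prob (random_subset N p) {K. card (N \<inter> K) \<le> p * card N - t}
      = measure_pmf.prob (binomial_pmf (card N) p) {x. x \<le> card N * p - t}"
    by (subst card_Int_random_subset[OF assms(1) subset_refl assms(3), symmetric])
       (simp add: vimage_def mult.commute)
  also have "\<dots> \<le> exp (- 2 * t\<^sup>2 / card N)"
    using assms by (intro prob_le) (auto simp: card_gt_0_iff)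
  finally show ?thesis .
qed

section \<open>Counting the outputs of a query tree\<close>

text \<open>The output of a deterministic tree is determined by the answers it receives. Although a
  node branches over all reals, only the answers in \<open>V\<close> can occur, so at most
  \<open>card V ^ m\<close> leaves are reachable within \<open>m\<close> queries.\<close>

lemma card_run_outputs_le:
  fixes V :: "real set"
  assumes "finite V" "\<And>f Q. f \<in> F \<Longrightarrow> f Q \<in> V"
  shows "finite {run_output t f |f. f \<in> F \<and> length (run_queries t f) \<le> m} \<and>
         card {run_output t f |f. f \<in> F \<and> length (run_queries t f) \<le> m} \<le> card V ^ m"
    (is "finite (?R t m) \<and> _")
proof (cases "F = {}")
  case False
  \<comment> \<open>A tree that returns early still contributes one output, which
    \<open>card V ^ m\<close> covers only if \<open>V\<close> is nonempty; hence the separate case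
    of empty \<open>F\<close>.\<close>
  then have V: "1 \<le> card V"
    using assms by (metis all_not_in_conv card_0_eq less_one not_le)
  show ?thesis
  proof (induction m arbitrary: t)
    case 0
    show ?case
    proof (cases t)
      case (Return S)
      then have "?R t 0 \<subseteq> {S}" by auto
      then show ?thesis
        using card_mono[of "{S}" "?R t 0"] by (auto intro: finite_subset)
    next
      case (Query Q g)
      then have "?R t 0 = {}" by auto
      then show ?thesis by (metis card.empty finite.emptyI le0)
    qed
  next
    case (Suc m)
    show ?case
    proof (cases t)
      case (Return S)
      then have "?R t (Suc m) \<subseteq> {S}" by auto
      then have "finite (?R t (Suc m))" "card (?R t (Suc m)) \<le> 1"
        using card_mono[of "{S}" "?R t (Suc m)"] by (auto intro: finite_subset)
      then show ?thesis using one_le_power[OF V, of "Suc m"] by linarith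
    next
      case (Query Q g)
      \<comment> \<open>The first answer \<open>v\<close> selects the subtree \<open>g v\<close> and
        leaves \<open>m\<close> queries.\<close>
      let ?U = "\<Union>v\<in>V. ?R (g v) m"
      have sub: "?R t (Suc m) \<subseteq> ?U"
        using Query assms(2) by fastforce
      have fin: "finite ?U" using Suc assms(1) by blast
      have "card ?U \<le> (\<Sum>v\<in>V. card (?R (g v) m))"
        by (rule card_UN_le[OF assms(1)])
      also have "\<dots> \<le> (\<Sum>v\<in>V. card V ^ m)"
        using Suc by (intro sum_mono) blast
      finally have "card ?U \<le> card V ^ Suc m" by simp
      then show ?thesis
        using card_mono[OF fin sub] finite_subset[OF sub fin] by linarith
    qed
  qed
qed auto

section \<open>Averages over the random instance\<close>

text \<open>
  The union bound controls the runs with at most \<open>m\<close> queries, and Markov's inequality the others.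
\<close>

lemma expected_overlap_run_output_le:
  fixes p t :: real
  assumes "finite N" "p \<in> {0..1}" "0 < t"
    and out: "\<And>K. K \<subseteq> N \<Longrightarrow> run_output T (overlap K) \<subseteq> N \<and> card (run_output T (overlap K)) \<le> k"
  shows "(\<Sum>K\<in>Pow N. pmf (random_subset N p) K * overlap K (run_output T (overlap K)))
    \<le> p * k + t + card N * (real (card N + 1) ^ m * exp (- 2 * t\<^sup>2 / card N))
      + card N / real (m + 1) *
          (\<Sum>K\<in>Pow N. pmf (random_subset N p) K * length (run_queries T (overlap K)))"
proof -
  define D where "D = random_subset N p"
  define X where "X K = run_output T (overlap K)" for K
  define L where "L K = real (length (run_queries T (overlap K)))" for K
  define B where "B = {K\<in>Pow N. L K \<le> m \<and> p * k + t \<le> overlap K (X K)}"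
  define R where "R = {run_output T f |f. f \<in> overlap ` Pow N \<and> length (run_queries T f) \<le> m}"
  \<comment> \<open>Since \<open>K\<close> lies in \<open>N\<close>, every query, even one outside
    \<open>N\<close>, is answered by an integer from \<open>0\<close> to
    \<open>card N\<close>.\<close>
  have R: "finite R \<and> card R \<le> card (real ` {..card N}) ^ m"
    unfolding R_def using assms(1)
    by (intro card_run_outputs_le) (auto simp: overlap_def intro!: imageI card_mono)
  then have cardR: "card R \<le> (card N + 1) ^ m"
    by (simp add: card_image)
  have finB: "finite B" using assms(1) by (simp add: B_def)
  \<comment> \<open>The output \<open>X K\<close> depends on \<open>K\<close>, so the tail bound
    does not apply to it directly; it applies to each fixed \<open>S\<close> in
    \<open>R\<close>.\<close>
  have "B \<subseteq> (\<Union>S\<in>R. {K. p * k + t \<le> overlap K S})"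
    by (auto simp: B_def R_def X_def L_def)
  then have "measure_pmf.prob D B \<le> measure_pmf.prob D (\<Union>S\<in>R. {K. p * k + t \<le> overlap K S})"
    by (intro measure_pmf.finite_measure_mono) auto
  also have "\<dots> \<le> (\<Sum>S\<in>R. measure_pmf.prob D {K. p * k + t \<le> overlap K S})"
    using R by (intro measure_pmf.finite_measure_subadditive_finite) auto
  also have "\<dots> \<le> (\<Sum>S\<in>R. exp (- 2 * t\<^sup>2 / card N))"
    unfolding D_def using out assms by (intro sum_mono prob_overlap_ge) (auto simp: R_def)
  also have "\<dots> \<le> real (card N + 1) ^ m * exp (- 2 * t\<^sup>2 / card N)"
    using cardR by (simp, metis of_nat_Suc of_nat_le_iff of_nat_power)
  finally have B: "measure_pmf.prob D B \<le> real (card N + 1) ^ m * exp (- 2 * t\<^sup>2 / card N)" .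

  have pointwise: "overlap K (X K) \<le> (p * k + t) + card N * indicat_real B K
      + card N / real (m + 1) * L K" if K: "K \<in> Pow N" for K
  proof -
    have le: "overlap K (X K) \<le> card N"
      using K out assms(1) by (intro overlap_le_card) (auto simp: X_def)
    have nonneg: "0 \<le> p * k + t" "0 \<le> card N / real (m + 1) * L K"
      using assms by (auto simp: L_def)
    \<comment> \<open>One summand pays for each case. A count above \<open>m\<close> is at least
      \<open>m + 1\<close>, so the last summand then reaches \<open>card N\<close>: Markov's
      inequality in pointwise form.\<close>
    consider "overlap K (X K) < p * k + t" | "K \<in> B" | "real (m + 1) \<le> L K"
      using K by (force simp: B_def L_def)
    then show ?thesis
    proof cases
      case 1
      then show ?thesis using nonneg by (simp add: indicator_def)
    next
      case 2
      then show ?thesis using nonneg le by simp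
    next
      case 3
      then have "real (card N) * 1 \<le> real (card N) * (L K / real (m + 1))"
        by (intro mult_left_mono) auto
      then have "card N \<le> card N / real (m + 1) * L K" by simp
      moreover have "0 \<le> card N * indicat_real B K" by simp
      ultimately show ?thesis using nonneg le by linarith
    qed
  qed
  have "(\<Sum>K\<in>Pow N. pmf D K * overlap K (X K))
      \<le> (\<Sum>K\<in>Pow N. pmf D K * ((p * k + t) + card N * indicat_real B K + card N / real (m + 1) * L K))"
    using pointwise by (intro sum_mono mult_left_mono) auto
  also have "\<dots> = (p * k + t) * (\<Sum>K\<in>Pow N. pmf D K) + card N * (\<Sum>K\<in>Pow N. pmf D K * indicat_real B K)
      + card N / real (m + 1) * (\<Sum>K\<in>Pow N. pmf D K * L K)"
    by (simp add: sum.distrib sum_distrib_left sum_distrib_right algebra_simps)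
  also have "(\<Sum>K\<in>Pow N. pmf D K * indicat_real B K) = measure_pmf.prob D B"
    using assms(1) finB
    by (auto simp: measure_measure_pmf_finite B_def indicator_def intro!: sum.mono_neutral_cong_right)
  also have "(\<Sum>K\<in>Pow N. pmf D K) = 1"
    unfolding D_def by (rule sum_pmf_random_subset[OF assms(1)])
  finally show ?thesis
    using mult_left_mono[OF B, of "card N"] unfolding D_def X_def L_def by simp
qed

text \<open>The optimum is at least \<open>k - t\<close> unless \<open>K\<close> is unusually small,
  which has exponentially small probability and costs at most \<open>card N\<close>.\<close>

lemma expected_smc_opt_overlap_ge:
  fixes p t :: real
  assumes "finite N" "N \<noteq> {}" "p \<in> {0..1}" "0 < t" "real k = p * card N"
  shows "k - t - card N * exp (- 2 * t\<^sup>2 / card N)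
    \<le> (\<Sum>K\<in>Pow N. pmf (random_subset N p) K * smc_opt N k (overlap K))"
proof -
  define D where "D = random_subset N p"
  define B where "B = {K\<in>Pow N. card K \<le> p * card N - t}"
  have finB: "finite B" using assms(1) by (simp add: B_def)
  have "measure_pmf.prob D B \<le> measure_pmf.prob D {K. card (N \<inter> K) \<le> p * card N - t}"
    by (intro measure_pmf.finite_measure_mono) (auto simp: B_def Int_absorb1)
  also have "\<dots> \<le> exp (- 2 * t\<^sup>2 / card N)"
    unfolding D_def using assms by (intro prob_card_le) auto
  finally have B: "measure_pmf.prob D B \<le> exp (- 2 * t\<^sup>2 / card N)" .
  \<comment> \<open>This makes \<open>k - t - card N\<close> negative, so the pointwise bound is
    trivial on \<open>B\<close>.\<close>
  have k: "real k \<le> card N"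
    using assms(3) unfolding assms(5) by (simp add: mult_left_le_one_le)
  have pointwise: "k - t - card N * indicat_real B K \<le> smc_opt N k (overlap K)" if K: "K \<in> Pow N" for K
  proof -
    have "real (min k (card K)) \<le> smc_opt N k (overlap K)"
      using K assms by (intro min_card_le_smc_opt_overlap) auto
    moreover have "k - t - card N * indicat_real B K \<le> real (min k (card K))"
      using k K assms(4,5) by (auto simp: B_def indicator_def)
    ultimately show ?thesis by simp
  qed
  have "k - t - card N * exp (- 2 * t\<^sup>2 / card N) \<le> (k - t) * 1 - card N * measure_pmf.prob D B"
    using mult_left_mono[OF B, of "card N"] by simp
  also have "\<dots> = (k - t) * (\<Sum>K\<in>Pow N. pmf D K) - card N * (\<Sum>K\<in>Pow N. pmf D K * indicat_real B K)"
  proof -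
    have "(\<Sum>K\<in>Pow N. pmf D K * indicat_real B K) = measure_pmf.prob D B"
      using assms(1) finB
      by (auto simp: measure_measure_pmf_finite B_def indicator_def intro!: sum.mono_neutral_cong_right)
    then show ?thesis
      unfolding D_def by (simp add: sum_pmf_random_subset[OF assms(1)])
  qed
  also have "\<dots> = (\<Sum>K\<in>Pow N. pmf D K * (k - t - card N * indicat_real B K))"
    by (simp add: right_diff_distrib[where b = "_ - _"] sum_subtractf sum_distrib_left mult_ac)
  also have "\<dots> \<le> (\<Sum>K\<in>Pow N. pmf D K * smc_opt N k (overlap K))"
    using pointwise by (intro sum_mono mult_left_mono) auto
  finally show ?thesis unfolding D_def .
qed

section \<open>Yao's averaging argument\<close>

text \<open>The ratio and the query bound hold for every \<open>overlap K\<close>, hence on average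
  over \<open>K\<close>. Exchanging this finite average with the expectation over \<open>M\<close>
  leaves a deterministic tree for each outcome, to which
  \<open>expected_overlap_run_output_le\<close> applies. Keeping \<open>F\<close> abstract serves
  linear and submodular objectives alike.\<close>

lemma randomized_smc_lower_bound:
  fixes p t \<gamma> q :: real and N :: "'a set" and M :: "'w measure"
  assumes "finite N" "N \<noteq> {}" "p \<in> {0..1}" "0 < t" "real k = p * card N" "0 \<le> \<gamma>" "0 \<le> q"
    and F: "\<And>K. K \<subseteq> N \<Longrightarrow> overlap K \<in> F"
    and alg: "randomized_smc_algorithm F N k M A"
    and ratio: "guarantees_ratio F N k M A \<gamma>"
    and few: "\<And>f. f \<in> F \<Longrightarrow> expected_queries M A f \<le> ennreal q"
  shows "\<gamma> * (k - t - card N * exp (- 2 * t\<^sup>2 / card N))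
    \<le> p * k + t + card N * (real (card N + 1) ^ m * exp (- 2 * t\<^sup>2 / card N))
      + card N / real (m + 1) * q"
proof -
  interpret prob_space M
    using alg by (simp add: randomized_smc_algorithm_def)
  define w where "w = pmf (random_subset N p)"
  define G where "G K \<omega> = overlap K (run_output (A \<omega>) (overlap K))" for K \<omega>
  define L where "L K \<omega> = real (length (run_queries (A \<omega>) (overlap K)))" for K \<omega>
  have out: "run_output (A \<omega>) (overlap K) \<subseteq> N \<and> card (run_output (A \<omega>) (overlap K)) \<le> k"
    if "K \<subseteq> N" "\<omega> \<in> space M" for K \<omega>
    using alg F[OF that(1)] that(2) by (auto simp: randomized_smc_algorithm_def)
  have G_int: "integrable M (G K)" if K: "K \<subseteq> N" for K
  proof (rule integrable_const_bound[of _ "card N"])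
    show "AE \<omega> in M. norm (G K \<omega>) \<le> card N"
      using overlap_le_card[OF assms(1)] out[OF K]
      by (intro AE_I2) (auto simp: G_def overlap_def)
    have "(\<lambda>\<omega>. run_output (A \<omega>) (overlap K)) \<in> measurable M (count_space UNIV)"
      using alg F[OF K] by (auto simp: randomized_smc_algorithm_def)
    then show "G K \<in> borel_measurable M"
      unfolding G_def by (rule measurable_compose) simp
  qed
  \<comment> \<open>The number of queries need not be bounded over the outcomes, so integrability
    comes from the finite expectation rather than from a constant bound.\<close>
  have L_int: "integrable M (L K) \<and> (\<integral>\<omega>. L K \<omega> \<partial>M) \<le> q" if K: "K \<subseteq> N" for K
  proof -
    have "(\<lambda>\<omega>. length (run_queries (A \<omega>) (overlap K))) \<in> measurable M (count_space UNIV)"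
      using alg F[OF K] by (auto simp: randomized_smc_algorithm_def)
    then have meas: "L K \<in> borel_measurable M"
      unfolding L_def by (rule measurable_compose) simp
    have nn: "(\<integral>\<^sup>+\<omega>. ennreal (L K \<omega>) \<partial>M) \<le> ennreal q"
      using few[OF F[OF K]] by (simp add: expected_queries_def L_def ennreal_of_nat_eq_real_of_nat)
    then have int: "integrable M (L K)"
      using meas by (intro integrableI_nonneg) (auto simp: L_def less_top[symmetric] top_unique)
    moreover have "ennreal (\<integral>\<omega>. L K \<omega> \<partial>M) \<le> ennreal q"
      using nn by (subst nn_integral_eq_integral[OF int, symmetric]) (auto simp: L_def)
    ultimately show ?thesis using \<open>0 \<le> q\<close> by simp
  qed
  have w: "0 \<le> w K" for K by (simp add: w_def)
  have L_sum_int: "integrable M (\<lambda>\<omega>. \<Sum>K\<in>Pow N. w K * L K \<omega>)"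
    using L_int by auto
  define C where
    "C = p * k + t + card N * (real (card N + 1) ^ m * exp (- 2 * t\<^sup>2 / card N))"
  have "\<gamma> * (k - t - card N * exp (- 2 * t\<^sup>2 / card N))
      \<le> \<gamma> * (\<Sum>K\<in>Pow N. w K * smc_opt N k (overlap K))"
    unfolding w_def using assms by (intro mult_left_mono expected_smc_opt_overlap_ge) auto
  also have "\<dots> = (\<Sum>K\<in>Pow N. w K * (\<gamma> * smc_opt N k (overlap K)))"
    by (simp add: sum_distrib_left mult_ac)
  also have "\<dots> \<le> (\<Sum>K\<in>Pow N. w K * (\<integral>\<omega>. G K \<omega> \<partial>M))"
    using ratio F w by (intro sum_mono mult_left_mono) (auto simp: guarantees_ratio_def G_def)
  also have "\<dots> = (\<integral>\<omega>. (\<Sum>K\<in>Pow N. w K * G K \<omega>) \<partial>M)"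
    using G_int by (subst Bochner_Integration.integral_sum) auto
  also have "\<dots> \<le> (\<integral>\<omega>. C + card N / real (m + 1) * (\<Sum>K\<in>Pow N. w K * L K \<omega>) \<partial>M)"
  proof (intro integral_mono)
    fix \<omega> assume "\<omega> \<in> space M"
    then show "(\<Sum>K\<in>Pow N. w K * G K \<omega>) \<le> C + card N / real (m + 1) * (\<Sum>K\<in>Pow N. w K * L K \<omega>)"
      unfolding w_def G_def L_def C_def
      using assms(1,3,4) out by (intro expected_overlap_run_output_le) auto
  next
    show "integrable M (\<lambda>\<omega>. C + card N / real (m + 1) * (\<Sum>K\<in>Pow N. w K * L K \<omega>))"
      using L_sum_int by (intro Bochner_Integration.integrable_add integrable_mult_right) auto
  qed (use G_int in auto)
  also have "\<dots> = C + card N / real (m + 1) * (\<Sum>K\<in>Pow N. w K * (\<integral>\<omega>. L K \<omega> \<partial>M))"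
  proof -
    have "(\<integral>\<omega>. (\<Sum>K\<in>Pow N. w K * L K \<omega>) \<partial>M) = (\<Sum>K\<in>Pow N. w K * (\<integral>\<omega>. L K \<omega> \<partial>M))"
      using L_int by (subst Bochner_Integration.integral_sum) auto
    then show ?thesis
      using L_sum_int by (subst Bochner_Integration.integral_add) (auto simp: prob_space)
  qed
  also have "\<dots> \<le> C + card N / real (m + 1) * (\<Sum>K\<in>Pow N. w K * q)"
    using L_int w by (intro add_left_mono mult_left_mono sum_mono) auto
  also have "(\<Sum>K\<in>Pow N. w K * q) = q"
    unfolding w_def using sum_pmf_random_subset[OF assms(1)] by (simp flip: sum_distrib_right)
  finally show ?thesis unfolding C_def .
qed

section \<open>Choice of the parameters\<close>

text \<open>With deviation \<open>\<delta> * n\<close>, every error term is at most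
  \<open>\<delta>\<close> after division by \<open>n\<close>. What remains is \<open>(p +
  \<epsilon>) * (p - 2 * \<delta>) \<le> p * p + 3 * \<delta>\<close>, which the choice of
  \<open>\<delta>\<close> contradicts.\<close>

lemma linear_over_log_queries:
  fixes p \<epsilon> \<delta> :: real and N :: "'a set" and M :: "'w measure"
  defines "\<delta> \<equiv> \<epsilon> * p / (4 * (p + \<epsilon> + 1))"
  assumes p: "0 < p" "p < 1" and "0 < \<epsilon>"
    and N: "finite N" "2 \<le> card N" "real k = p * card N"
    and large: "exp (- (\<delta>\<^sup>2 * card N)) \<le> \<delta>"
    and F: "\<And>K. K \<subseteq> N \<Longrightarrow> overlap K \<in> F"
    and alg: "randomized_smc_algorithm F N k M A"
    and ratio: "guarantees_ratio F N k M A (p + \<epsilon>)"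
  shows "\<exists>f\<in>F. ennreal (\<delta> ^ 3 / 2 * (card N / ln (card N))) \<le> expected_queries M A f"
proof (rule ccontr)
  assume few: "\<not> ?thesis"
  define n where "n = real (card N)"
  define q where "q = \<delta> ^ 3 / 2 * (n / ln n)"
  \<comment> \<open>Chosen so that the number of outputs, at most \<open>n ^ (2 * m)\<close>, uses
    up only half of the Hoeffding exponent \<open>2 * \<delta>^2 * n\<close>.\<close>
  define m where "m = nat \<lfloor>\<delta>\<^sup>2 / 2 * (n / ln n)\<rfloor>"
  have n: "2 \<le> n" using N by (simp add: n_def)
  then have ln: "0 < ln n" by simp
  have \<delta>: "0 < \<delta>" unfolding \<delta>_def using p \<open>0 < \<epsilon>\<close> by simp
  have q: "0 \<le> q" unfolding q_def using n ln \<delta> by simp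
  have e1: "exp (- 2 * (\<delta> * n)\<^sup>2 / n) = exp (- 2 * \<delta>\<^sup>2 * n)"
    using n by (simp add: power2_eq_square)
  have "exp (- 2 * \<delta>\<^sup>2 * n) \<le> exp (- (\<delta>\<^sup>2 * n))"
    using n by simp
  also have "\<dots> \<le> \<delta>" using large by (simp add: n_def)
  finally have e2: "exp (- 2 * \<delta>\<^sup>2 * n) \<le> \<delta>" .
  have "real m \<le> \<delta>\<^sup>2 / 2 * (n / ln n)"
    unfolding m_def using n ln by (intro of_nat_floor) simp
  then have m_ln: "m * ln n \<le> \<delta>\<^sup>2 / 2 * n"
    using ln by (simp add: field_simps)
  have m1: "\<delta>\<^sup>2 / 2 * (n / ln n) \<le> real (m + 1)"
    unfolding m_def by linarith
  have "(n + 1) ^ m \<le> (n ^ 2) ^ m"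
  proof (intro power_mono)
    have "n * 2 \<le> n * n" using n by (intro mult_left_mono) auto
    then show "n + 1 \<le> n\<^sup>2" using n unfolding power2_eq_square by linarith
  qed (use n in auto)
  also have "\<dots> = exp (ln n) ^ (2 * m)"
    using n by (simp add: power_mult)
  also have "\<dots> = exp (2 * (m * ln n))"
    by (simp add: mult.assoc flip: exp_of_nat_mult)
  also have "\<dots> \<le> exp (\<delta>\<^sup>2 * n)" using m_ln by simp
  finally have "(n + 1) ^ m * exp (- 2 * \<delta>\<^sup>2 * n) \<le> exp (\<delta>\<^sup>2 * n) * exp (- 2 * \<delta>\<^sup>2 * n)"
    by (intro mult_right_mono) auto
  also have "\<dots> = exp (- (\<delta>\<^sup>2 * n))" by (simp flip: exp_add)
  also have "\<dots> \<le> \<delta>" using large by (simp add: n_def)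
  finally have e3: "(n + 1) ^ m * exp (- 2 * \<delta>\<^sup>2 * n) \<le> \<delta>" .
  \<comment> \<open>The constant in \<open>q\<close> has one more factor \<open>\<delta>\<close>
    than that in \<open>m\<close>, which makes the Markov term small. Rounding down in
    \<open>m\<close> is harmless because the divisor is \<open>m + 1\<close>.\<close>
  have "q = \<delta> * (\<delta>\<^sup>2 / 2 * (n / ln n))"
    by (simp add: q_def power2_eq_square power3_eq_cube)
  also have "\<dots> \<le> \<delta> * real (m + 1)"
    using m1 \<delta> by (intro mult_left_mono) auto
  finally have e4: "q / real (m + 1) \<le> \<delta>"
    by (simp add: divide_le_eq)
  have "(p + \<epsilon>) * (k - \<delta> * n - n * exp (- 2 * (\<delta> * n)\<^sup>2 / n))
    \<le> p * k + \<delta> * n + n * ((n + 1) ^ m * exp (- 2 * (\<delta> * n)\<^sup>2 / n)) + n / real (m + 1) * q"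
    using randomized_smc_lower_bound[OF N(1) _ _ _ N(3) _ q F alg ratio, of "\<delta> * n" m]
      few p \<open>0 < \<epsilon>\<close> \<delta> n N by (force simp: n_def q_def add.commute)
  then have "(p + \<epsilon>) * (p * n - \<delta> * n - n * exp (- 2 * \<delta>\<^sup>2 * n))
    \<le> p * (p * n) + \<delta> * n + n * ((n + 1) ^ m * exp (- 2 * \<delta>\<^sup>2 * n)) + n * (q / real (m + 1))"
    unfolding e1 using N(3) by (simp add: n_def)
  then have "n * ((p + \<epsilon>) * (p - \<delta> - exp (- 2 * \<delta>\<^sup>2 * n)))
    \<le> n * (p * p + \<delta> + (n + 1) ^ m * exp (- 2 * \<delta>\<^sup>2 * n) + q / real (m + 1))"
    by (simp add: algebra_simps)
  then have "(p + \<epsilon>) * (p - \<delta> - exp (- 2 * \<delta>\<^sup>2 * n))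
    \<le> p * p + \<delta> + (n + 1) ^ m * exp (- 2 * \<delta>\<^sup>2 * n) + q / real (m + 1)"
    using n by (subst (asm) mult_le_cancel_left_pos) auto
  moreover have "(p + \<epsilon>) * (p - \<delta> - \<delta>) \<le> (p + \<epsilon>) * (p - \<delta> - exp (- 2 * \<delta>\<^sup>2 * n))"
    using e2 p \<open>0 < \<epsilon>\<close> by (intro mult_left_mono) auto
  ultimately have "(p + \<epsilon>) * (p - 2 * \<delta>) \<le> p * p + 3 * \<delta>"
    using e3 e4 by simp
  then have "\<epsilon> * p \<le> (2 * (p + \<epsilon>) + 3) * \<delta>"
    by (simp add: algebra_simps)
  \<comment> \<open>The slack between the two factors is \<open>2 * (p + \<epsilon>) + 1\<close>; it
    provides the strict inequality that the contradiction needs.\<close>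
  also have "\<dots> < (4 * (p + \<epsilon> + 1)) * \<delta>"
    using p \<open>0 < \<epsilon>\<close> \<delta> by (intro mult_strict_right_mono) auto
  also have "\<dots> = \<epsilon> * p"
    unfolding \<delta>_def using p \<open>0 < \<epsilon>\<close> by simp
  finally show False by simp
qed

text \<open>Bounding the expected number of queries on some objective also bounds the worst case
  over the internal randomness.\<close>

theorem theorem5:
  fixes \<beta> \<epsilon> :: real
  assumes "\<beta> \<in> \<rat>" and "0 < \<beta>" and "\<beta> < 1" and "0 < \<epsilon>"
  shows "\<exists>c>0. \<exists>n0::nat. \<forall>(N :: 'a set) (k::nat) (M :: 'w measure) (A :: 'w \<Rightarrow> 'a query_tree).
    finite N \<and> n0 \<le> card N \<and> real k = \<beta> * real (card N) \<longrightarrow>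
    (randomized_smc_algorithm (smc_objectives N) N k M A \<and>
     guarantees_ratio (smc_objectives N) N k M A (\<beta> + \<epsilon>) \<longrightarrow>
       (\<exists>f\<in>smc_objectives N.
          ennreal (c * (real (card N) / ln (real (card N)))) \<le> expected_queries M A f)) \<and>
    (randomized_smc_algorithm (linear_objectives N) N k M A \<and>
     guarantees_ratio (linear_objectives N) N k M A (\<beta> + \<epsilon>) \<longrightarrow>
       (\<exists>f\<in>linear_objectives N.
          ennreal (c * (real (card N) / ln (real (card N)))) \<le> expected_queries M A f))"
proof -
  define \<delta> where "\<delta> = \<epsilon> * \<beta> / (4 * (\<beta> + \<epsilon> + 1))"
  have \<delta>: "0 < \<delta>" unfolding \<delta>_def using assms by simp
  \<comment> \<open>The bound \<open>1 / \<delta> ^ 3\<close> gives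
    \<open>1 \<le> \<delta> * (\<delta>^2 * n)\<close>, and the exponential exceeds its argument;
    the bound \<open>2\<close> keeps \<open>ln n\<close> positive.\<close>
  define n0 where "n0 = max 2 (nat \<lceil>1 / \<delta> ^ 3\<rceil>)"
  have large: "exp (- (\<delta>\<^sup>2 * real n)) \<le> \<delta>" if "n0 \<le> n" for n
  proof -
    have "1 / \<delta> ^ 3 \<le> real n"
      using that unfolding n0_def by linarith
    then have "1 \<le> \<delta> * (\<delta>\<^sup>2 * real n)"
      using \<delta> by (simp add: field_simps power2_eq_square power3_eq_cube)
    also have "\<dots> \<le> \<delta> * exp (\<delta>\<^sup>2 * real n)"
      using \<delta> exp_ge_add_one_self[of "\<delta>\<^sup>2 * real n"] by (intro mult_left_mono) linarith+
    finally show ?thesis by (simp add: exp_minus field_simps)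
  qed
  \<comment> \<open>The hard instances are linear, so any class containing the linear objectives
    will do; both claims are instances with the same constants.\<close>
  have lower: "\<exists>f\<in>F. ennreal (\<delta> ^ 3 / 2 * (card N / ln (card N))) \<le> expected_queries M A f"
    if "finite N" "n0 \<le> card N" "real k = \<beta> * card N" "linear_objectives N \<subseteq> F"
      "randomized_smc_algorithm F N k M A" "guarantees_ratio F N k M A (\<beta> + \<epsilon>)"
    for N :: "'a set" and k F and M :: "'w measure" and A
    unfolding \<delta>_def
  proof (rule linear_over_log_queries)
    show "2 \<le> card N" using that(2) by (simp add: n0_def)
    show "exp (- ((\<epsilon> * \<beta> / (4 * (\<beta> + \<epsilon> + 1)))\<^sup>2 * card N)) \<le> \<epsilon> * \<beta> / (4 * (\<beta> + \<epsilon> + 1))"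
      using large[OF that(2)] unfolding \<delta>_def .
    show "overlap K \<in> F" for K
      using overlap_in_linear_objectives[OF that(1)] that(4) by blast
  qed (use assms that in auto)
  show ?thesis
  proof (intro exI[of _ "\<delta> ^ 3 / 2"] exI[of _ n0] conjI allI impI; (elim conjE)?)
    show "0 < \<delta> ^ 3 / 2" using \<delta> by simp
  qed (rule lower; use linear_objectives_subset_smc_objectives in blast)+
qed

end
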